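(* For every $M\ge1$, with $S=M+1$, the ADER-IWF-RK-GLB method with $S$ stages is the Lobatto IIIC Runge–Kutta method with $S$ stages (i.e., the coefficients $A,\boldsymbol{b},\boldsymbol{c}$ of the two methods coincide).
   Context: A Runge–Kutta (RK) method with $S$ stages is given by coefficients $A=(a_{i,j})$, $\boldsymbol{b}=(b_i)$, $\boldsymbol{c}=(c_i)$, $i,j=0,\dots,S-1$. Lobatto IIIC method with $S\ge2$ stages: the unique RK method such that $\boldsymbol{c}$ and $\boldsymbol{b}$ are the $S$ Gauss–Lobatto quadrature points on $[0,1]$ and the associated weights, and the $a_{i,j}$ satisfy $a_{i,0}=b_0$ for $i=0,\dots,S-1$ together with the condition $\mathcal{C}(S-1)$: $\sum_{j=0}^{S-1}a_{i,j}c_j^{z-1}=\frac{c_i^z}{z}$ for all $i=0,\dots,S-1$ and $z=1,\dots,S-1$. ADER-IWF-RK-GLB method: let $0=\xi^0<\dots<\xi^M=1$ be the $M+1$ Gauss–Lobatto points on $[0,1]$ (the endpoints and the roots of the derivative of the degree-$M$ Legendre polynomial shifted to $[0,1]$), $\widehat\psi^m$, $m=0,\dots,M$, the associated Lagrange basis polynomials of degree $M$, and $w_m=\int_0^1\widehat\psi^m(\xi)\,d\xi$ the quadrature weights (the rule is exact for polynomials of degree at most $2M-1$). Define, with all integrals computed by this quadrature, $$B_{\ell,m}=\widehat\psi^\ell(1)\widehat\psi^m(1)-\sum_{q=0}^M w_q\Big(\tfrac{d}{d\xi}\widehat\psi^\ell\Big)(\xi^q)\,\widehat\psi^m(\xi^q),\qquad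 \Lambda_{\ell,m}=\sum_{q=0}^M w_q\widehat\psi^\ell(\xi^q)\widehat\psi^m(\xi^q)=w_\ell\delta_{\ell,m}.$$ The method is the RK method with $S=M+1$ stages, $A=B^{-1}\Lambda$, $c_m=\xi^m$, $b_m=w_m$. *)

theory Defs
  imports
    "HOL-Analysis.Analysis"
    "HOL-Computational_Algebra.Polynomial"
    "Jordan_Normal_Form.Gauss_Jordan_Elimination"
begin

unbundle no vec_syntax
hide_const (open) Finite_Cartesian_Product.vec Finite_Cartesian_Product.mat
  Determinants.det Finite_Cartesian_Product.row Finite_Cartesian_Product.column
hide_const (open) Module.smult
hide_type (open) Finite_Cartesian_Product.vec

(* Coefficients are indexed from 0; the sizes are carried by the matrix and the vectors,
   so that equality of two records is equality of all coefficients. *)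
record rk_method =
  rk_A :: "real Matrix.mat"
  rk_b :: "real Matrix.vec"
  rk_c :: "real Matrix.vec"

definition rk_stages :: "nat \<Rightarrow> rk_method \<Rightarrow> bool" where
  "rk_stages S R \<longleftrightarrow>
     rk_A R \<in> carrier_mat S S \<and> rk_b R \<in> carrier_vec S \<and> rk_c R \<in> carrier_vec S"

(* Rodrigues' formula on [-1,1]. *)
definition legendre :: "nat \<Rightarrow> real poly" where
  "legendre n = smult (1 / (2 ^ n * fact n)) ((pderiv ^^ n) ([:-1, 0, 1:] ^ n))"

definition shifted_legendre :: "nat \<Rightarrow> real poly" where
  "shifted_legendre n = pcompose (legendre n) [:-1, 2:]"

(* For M >= 1 this set has M + 1 elements; gl_node M m, for m = 0..M, lists them increasingly. *)
definition gl_nodes :: "nat \<Rightarrow> real set" where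
  "gl_nodes M = {0, 1} \<union> {x. poly (pderiv (shifted_legendre M)) x = 0}"

definition gl_node :: "nat \<Rightarrow> nat \<Rightarrow> real" where
  "gl_node M m = sorted_list_of_set (gl_nodes M) ! m"

definition gl_lagrange :: "nat \<Rightarrow> nat \<Rightarrow> real poly" where
  "gl_lagrange M m =
     (\<Prod>k\<in>{..M} - {m}. smult (1 / (gl_node M m - gl_node M k)) [:- gl_node M k, 1:])"

definition gl_weight :: "nat \<Rightarrow> nat \<Rightarrow> real" where
  "gl_weight M m = integral {0..1} (poly (gl_lagrange M m))"

definition gl_quadrature :: "nat \<Rightarrow> (real \<Rightarrow> real) \<Rightarrow> real" where
  "gl_quadrature M f = (\<Sum>q\<le>M. gl_weight M q * f (gl_node M q))"

definition ader_B :: "nat \<Rightarrow> real Matrix.mat" where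
  "ader_B M = Matrix.mat (M + 1) (M + 1) (\<lambda>(l, m).
     poly (gl_lagrange M l) 1 * poly (gl_lagrange M m) 1
     - gl_quadrature M (\<lambda>x. poly (pderiv (gl_lagrange M l)) x * poly (gl_lagrange M m) x))"

definition ader_Lambda :: "nat \<Rightarrow> real Matrix.mat" where
  "ader_Lambda M = Matrix.mat (M + 1) (M + 1) (\<lambda>(l, m).
     gl_quadrature M (\<lambda>x. poly (gl_lagrange M l) x * poly (gl_lagrange M m) x))"

(* The value of mat_inverse is Some of the inverse exactly when the matrix is invertible,
   so rk_A is meaningful only together with invertibility of ader_B M. *)
definition ader_iwf_rk_glb :: "nat \<Rightarrow> rk_method" where
  "ader_iwf_rk_glb M =
     \<lparr> rk_A = the (mat_inverse (ader_B M)) * ader_Lambda M,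
       rk_b = Matrix.vec (M + 1) (gl_weight M),
       rk_c = Matrix.vec (M + 1) (gl_node M) \<rparr>"

(* The simplifying condition C(p); for z = 1 and c_j = 0 the factor c_j^(z-1) is 0^0 = 1. *)
definition rk_C :: "nat \<Rightarrow> nat \<Rightarrow> rk_method \<Rightarrow> bool" where
  "rk_C S p R \<longleftrightarrow> (\<forall>i<S. \<forall>z\<in>{1..p}.
     (\<Sum>j<S. rk_A R $$ (i, j) * (rk_c R $ j) ^ (z - 1)) = (rk_c R $ i) ^ z / real z)"

definition is_lobatto_IIIC :: "nat \<Rightarrow> rk_method \<Rightarrow> bool" where
  "is_lobatto_IIIC S R \<longleftrightarrow>
     rk_stages S R
     \<and> (\<forall>i<S. rk_c R $ i = gl_node (S - 1) i)
     \<and> (\<forall>i<S. rk_b R $ i = gl_weight (S - 1) i)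
     \<and> (\<forall>i<S. rk_A R $$ (i, 0) = rk_b R $ 0)
     \<and> rk_C S (S - 1) R"

(* Well defined for S >= 2 only. *)
definition lobatto_IIIC :: "nat \<Rightarrow> rk_method" where
  "lobatto_IIIC S = (THE R. is_lobatto_IIIC S R)"

end

theory Submission
  imports Defs "Jordan_Normal_Form.Determinant"
begin

text \<open>
  The nodes are the roots of \<open>x (1 - x) P\<^sub>M'(x)\<close>, and \<open>P\<^sub>M\<close> is orthogonal to all polynomials of degree
  below \<open>M\<close>, so the quadrature is exact up to degree \<open>2 M - 1\<close>. Integration by parts is therefore
  valid for the discrete integrals in \<open>B\<close>: applied to the nodal values of a polynomial \<open>p\<close> of degree
  at most \<open>M\<close>, the matrix \<open>B\<close> gives \<open>\<delta>\<^sub>l\<^sub>0 p(0) + w\<^sub>l p'(\<xi>\<^sup>l)\<close>. Since \<open>w\<^sub>l > 0\<close> for \<open>l \<ge> 1\<close>, a kernel vector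
  has \<open>p' = 0\<close> at \<open>M\<close> nodes and \<open>p(0) = 0\<close>, so \<open>B\<close> is invertible. Taking \<open>p = w\<^sub>0\<close> shows that the first
  column of \<open>B\<^sup>-\<^sup>1 \<Lambda>\<close> is constantly \<open>w\<^sub>0\<close>, and \<open>p = x\<^sup>z / z\<close> gives the condition \<open>C(M)\<close>.
\<close>

(* Importing Determinant makes the constant hidden in Defs visible again. *)
hide_const (open) Module.smult

subsection \<open>Integrals of polynomials over the unit interval\<close>

definition poly_integral :: "real poly \<Rightarrow> real" where
  "poly_integral p = integral {0..1} (poly p)"

lemma poly_integrable_on: "poly p integrable_on {a..b::real}"
  by (intro integrable_continuous_real continuous_intros)

lemma poly_integral_0 [simp]: "poly_integral 0 = 0"
  by (simp add: poly_integral_def cong: Henstock_Kurzweil_Integration.integral_cong)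

lemma poly_integral_add: "poly_integral (p + q) = poly_integral p + poly_integral q"
  unfolding poly_integral_def poly_add
  by (intro Henstock_Kurzweil_Integration.integral_add poly_integrable_on)

lemma poly_integral_smult: "poly_integral (smult c p) = c * poly_integral p"
  by (simp add: poly_integral_def cong: Henstock_Kurzweil_Integration.integral_cong)

lemma poly_integral_sum: "poly_integral (sum f A) = (\<Sum>x\<in>A. poly_integral (f x))"
  by (induction A rule: infinite_finite_induct) (simp_all add: poly_integral_add)

lemma poly_integral_pderiv: "poly_integral (pderiv p) = poly p 1 - poly p 0"
proof -
  have "(poly (pderiv p) has_integral (poly p 1 - poly p 0)) {0..1}"
    by (rule fundamental_theorem_of_calculus)
      (auto simp flip: has_real_derivative_iff_has_vector_derivative
        intro: DERIV_subset[OF poly_DERIV])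
  then show ?thesis
    by (simp add: poly_integral_def integral_unique)
qed

lemma poly_integral_by_parts:
  "poly_integral (pderiv p * q) =
     poly p 1 * poly q 1 - poly p 0 * poly q 0 - poly_integral (p * pderiv q)"
proof -
  have "poly_integral (pderiv (p * q)) = poly_integral (pderiv p * q) + poly_integral (p * pderiv q)"
    by (simp add: pderiv_mult poly_integral_add algebra_simps)
  then show ?thesis
    by (simp add: poly_integral_pderiv)
qed

text \<open>A continuous nonnegative function with zero integral vanishes on the whole interval, and
  a nonzero polynomial has only finitely many roots.\<close>

lemma poly_integral_pos:
  assumes "\<And>x. x \<in> {0..1} \<Longrightarrow> poly p x \<ge> 0" and "p \<noteq> 0"
  shows "poly_integral p > 0"
proof -
  have "poly_integral p \<ge> 0"
    unfolding poly_integral_def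
    by (intro Henstock_Kurzweil_Integration.integral_nonneg poly_integrable_on assms)
  moreover have "poly_integral p \<noteq> 0"
  proof
    assume "poly_integral p = 0"
    then have "\<forall>x\<in>{0..1}. poly p x = 0"
      using integral_eq_0_iff[of 0 1 "poly p"] assms(1)
      by (simp add: poly_integral_def continuous_on_poly)
    then have "{0..1} \<subseteq> {x. poly p x = 0}"
      by auto
    then have "finite {0..1::real}"
      using poly_roots_finite[OF \<open>p \<noteq> 0\<close>] finite_subset by blast
    then show False
      by (simp add: infinite_Icc)
  qed
  ultimately show ?thesis
    by simp
qed

subsection \<open>Shifted Legendre polynomials\<close>

lemma higher_pderiv_pcompose_linear:
  "(pderiv ^^ n) (pcompose p [:a, b:]) =
     smult (b ^ n) (pcompose ((pderiv ^^ n) p) [:a, b:])" for p :: "real poly"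
  by (induction n) (simp_all add: pderiv_smult pderiv_pcompose pderiv_pCons algebra_simps)

lemma pcompose_power: "pcompose (p ^ n) q = pcompose p q ^ n" for p q :: "real poly"
  by (induction n) (simp_all add: pcompose_mult pcompose_1)

text \<open>The substitution x -> 2 x - 1 turns x^2 - 1 into 4 (x^2 - x), whose roots are the
  endpoints 0 and 1. Orthogonality and the location of roots are insensitive to the scaling, so only
  \<open>c \<noteq> 0\<close> is recorded.\<close>

lemma shifted_legendre_Rodrigues:
  obtains c where "c \<noteq> 0"
    and "shifted_legendre n = smult c ((pderiv ^^ n) ([:0, -1, 1:] ^ n))"
proof
  have sq: "pcompose [:-1, 0, 1:] [:-1, 2:] = smult 4 [:0, -1, 1::real:]"
    by (simp add: pcompose_pCons)
  have "smult (2 ^ n) (pcompose ((pderiv ^^ n) ([:-1, 0, 1:] ^ n)) [:-1, 2:]) =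
      (pderiv ^^ n) (smult 4 [:0, -1, 1::real:] ^ n)"
    by (simp only: higher_pderiv_pcompose_linear[symmetric] pcompose_power sq)
  also have "\<dots> = smult (4 ^ n) ((pderiv ^^ n) ([:0, -1, 1:] ^ n))"
    by (simp only: smult_power higher_pderiv_smult)
  finally have "smult (1 / 2 ^ n) (smult (2 ^ n) (pcompose ((pderiv ^^ n) ([:-1, 0, 1:] ^ n)) [:-1, 2:])) =
      smult (1 / 2 ^ n) (smult (4 ^ n) ((pderiv ^^ n) ([:0, -1, 1::real:] ^ n)))"
    by simp
  then have "pcompose ((pderiv ^^ n) ([:-1, 0, 1:] ^ n)) [:-1, 2:] =
      smult (4 ^ n / 2 ^ n) ((pderiv ^^ n) ([:0, -1, 1::real:] ^ n))"
    by simp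
  then show "shifted_legendre n =
      smult (1 / (2 ^ n * fact n) * (4 ^ n / 2 ^ n)) ((pderiv ^^ n) ([:0, -1, 1:] ^ n))"
    by (simp add: shifted_legendre_def legendre_def pcompose_smult)
qed simp

lemma power_dvd_pderiv:
  fixes p q :: "real poly"
  assumes "q ^ Suc m dvd p"
  shows "q ^ m dvd pderiv p"
proof -
  obtain r where "p = q ^ Suc m * r"
    using assms by (elim dvdE)
  then have "pderiv p = q ^ Suc m * pderiv r + r * (smult (of_nat (Suc m)) (q ^ m) * pderiv q)"
    by (simp only: pderiv_mult pderiv_power_Suc)
  also have "\<dots> = q ^ m * (q * pderiv r + smult (of_nat (Suc m)) (r * pderiv q))"
    by (simp add: algebra_simps del: of_nat_Suc)
  finally show ?thesis
    by simp
qed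

lemma power_dvd_higher_pderiv_power:
  "k \<le> n \<Longrightarrow> q ^ (n - k) dvd (pderiv ^^ k) (q ^ n)" for q :: "real poly"
proof (induction k)
  case (Suc k)
  then have "q ^ Suc (n - Suc k) dvd (pderiv ^^ k) (q ^ n)"
    by (simp add: Suc_diff_Suc del: power_Suc)
  then show ?case
    using power_dvd_pderiv by simp
qed simp

text \<open>Each differentiation lowers the multiplicity of a root by at most one. For q = x^2 - x
  this kills the boundary terms in the integrations by parts and supplies the endpoints as extra
  roots for Rolle's theorem.\<close>

lemma higher_pderiv_power_root:
  fixes q :: "real poly"
  assumes "k < n" and "poly q x = 0"
  shows "poly ((pderiv ^^ k) (q ^ n)) x = 0"
proof -
  have "q dvd q ^ (n - k)"
    using assms by (simp add: dvd_power)
  also have "\<dots> dvd (pderiv ^^ k) (q ^ n)"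
    using assms by (intro power_dvd_higher_pderiv_power) simp
  finally show ?thesis
    using assms by auto
qed

lemma shifted_legendre_orthogonal:
  assumes "degree g < n"
  shows "poly_integral (shifted_legendre n * g) = 0"
proof -
  \<comment> \<open>Each integration by parts moves one derivative from the power to
    \<open>g\<close>. Hence \<open>g\<close> varies in the induction, and the degree bound is
    replaced by the vanishing of the \<open>k\<close>-th derivative, which gives
    \<open>g = 0\<close> at \<open>k = 0\<close>.\<close>
  have *: "poly_integral ((pderiv ^^ k) ([:0, -1, 1:] ^ n) * g) = 0"
    if "k \<le> n" "(pderiv ^^ k) g = 0" for k and g
    using that
  proof (induction k arbitrary: g)
    case (Suc k)
    have "poly_integral ((pderiv ^^ k) ([:0, -1, 1:] ^ n) * pderiv g) = 0"
      using Suc by (intro Suc.IH) (simp_all add: funpow_swap1)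
    then show ?case
      using Suc.prems by (simp add: poly_integral_by_parts higher_pderiv_power_root)
  qed simp
  have "(pderiv ^^ n) g = 0"
  proof (rule poly_eqI)
    fix i
    show "coeff ((pderiv ^^ n) g) i = coeff 0 i"
      using assms by (simp add: coeff_higher_pderiv coeff_eq_0)
  qed
  then have "poly_integral ((pderiv ^^ n) ([:0, -1, 1:] ^ n) * g) = 0"
    by (intro *) simp_all
  moreover obtain c where "shifted_legendre n = smult c ((pderiv ^^ n) ([:0, -1, 1:] ^ n))"
    using shifted_legendre_Rodrigues by blast
  ultimately show ?thesis
    by (simp add: poly_integral_smult)
qed

section \<open>Location of the critical points of the shifted Legendre polynomials\<close>

text \<open>Rolle's theorem between consecutive roots. Adding the roots in increasing order makes
  every new critical point larger than the old maximum, hence distinct from those already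
  found.\<close>

lemma pderiv_roots_between_roots:
  fixes p :: "real poly"
  assumes "finite Z" and "Z \<noteq> {}" and "\<And>z. z \<in> Z \<Longrightarrow> poly p z = 0"
  shows "\<exists>W. finite W \<and> Suc (card W) = card Z \<and> W \<subseteq> {Min Z<..<Max Z} \<and>
    (\<forall>w\<in>W. poly (pderiv p) w = 0)"
  using assms
proof (induction Z rule: finite_linorder_max_induct)
  case (insert z Z)
  show ?case
  proof (cases "Z = {}")
    case True
    then show ?thesis
      by (intro exI[of _ "{}"]) simp
  next
    case False
    then obtain W where W: "finite W" "Suc (card W) = card Z" "W \<subseteq> {Min Z<..<Max Z}"
      "\<forall>w\<in>W. poly (pderiv p) w = 0"
      using insert by auto
    have "Max Z \<in> Z"
      using False insert.hyps by simp
    then have "Max Z < z" and "Min Z \<le> Max Z" and "z \<notin> Z"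
      using insert.hyps by auto
    obtain x where x: "Max Z < x" "x < z" "poly (pderiv p) x = 0"
      using poly_MVT[OF \<open>Max Z < z\<close>, of p] insert.prems \<open>Max Z \<in> Z\<close> \<open>Max Z < z\<close> by auto
    have "x \<notin> W"
      using W(3) x by force
    moreover have "Max (insert z Z) = z" and "Min (insert z Z) = Min Z"
      using False insert.hyps \<open>Max Z < z\<close> \<open>Min Z \<le> Max Z\<close> by (simp_all add: Max_insert Min_insert)
    ultimately show ?thesis
      using W x insert.hyps \<open>z \<notin> Z\<close> \<open>Min Z \<le> Max Z\<close> \<open>Max Z < z\<close>
      by (intro exI[of _ "insert x W"]) auto
  qed
qed simp

lemma higher_pderiv_roots_unit_interval:
  "k \<le> n \<Longrightarrow> \<exists>W. finite W \<and> card W = k \<and> W \<subseteq> {0<..<1} \<and>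
     (\<forall>w\<in>W. poly ((pderiv ^^ k) ([:0, -1, 1:] ^ n)) w = (0::real))"
proof (induction k)
  case (Suc k)
  then obtain W where W: "finite W" "card W = k" "W \<subseteq> {0<..<1}"
    "\<forall>w\<in>W. poly ((pderiv ^^ k) ([:0, -1, 1:] ^ n)) w = (0::real)"
    by auto
  \<comment> \<open>As \<open>k < n\<close>, both endpoints are still roots of the
    \<open>k\<close>-th derivative; Rolle on these \<open>k + 2\<close> points yields
    \<open>k + 1\<close> interior roots of the next one.\<close>
  define Z where "Z = insert 0 (insert 1 W)"
  have roots: "poly ((pderiv ^^ k) ([:0, -1, 1:] ^ n)) z = (0::real)" if "z \<in> Z" for z
  proof (cases "z \<in> W")
    case False
    then have "poly [:0, -1, 1:] z = 0"
      using that by (auto simp: Z_def)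
    then show ?thesis
      using Suc.prems by (intro higher_pderiv_power_root) simp_all
  qed (use W in blast)
  have Z: "finite Z" "Z \<noteq> {}"
    using W by (simp_all add: Z_def)
  have "Min Z = 0"
    by (rule Min_eqI) (use W in \<open>auto simp: Z_def\<close>)
  have "Max Z = 1"
    by (rule Max_eqI) (use W in \<open>auto simp: Z_def\<close>)
  have "0 \<notin> insert 1 W" and "1 \<notin> W"
    using W(3) by auto
  then have "card Z = Suc (Suc k)"
    using W by (simp add: Z_def)
  then show ?case
    using pderiv_roots_between_roots[OF Z roots] unfolding \<open>Min Z = 0\<close> \<open>Max Z = 1\<close> by simp
qed (intro exI[of _ "{}"], simp)

lemma pderiv_shifted_legendre_roots:
  assumes "M \<ge> 1"
  shows "pderiv (shifted_legendre M) \<noteq> 0"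
    and "degree (pderiv (shifted_legendre M)) = M - 1"
    and "{x. poly (pderiv (shifted_legendre M)) x = 0} \<subseteq> {0<..<1}"
    and "card {x. poly (pderiv (shifted_legendre M)) x = 0} = M - 1"
proof -
  let ?u = "[:0, -1, 1:] ^ M :: real poly"
  obtain c where c: "c \<noteq> 0" "shifted_legendre M = smult c ((pderiv ^^ M) ?u)"
    using shifted_legendre_Rodrigues .
  have d: "pderiv (shifted_legendre M) = smult c ((pderiv ^^ Suc M) ?u)"
    by (simp add: c pderiv_smult)
  have degu: "degree ?u = 2 * M"
    by (subst degree_power_eq) auto
  then show deg: "degree (pderiv (shifted_legendre M)) = M - 1"
    using c d by (simp add: degree_higher_pderiv degree_pderiv)
  have "degree ((pderiv ^^ M) ?u) = M"
    by (simp add: degu degree_higher_pderiv)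
  then show nz: "pderiv (shifted_legendre M) \<noteq> 0"
    using assms c d pderiv_eq_0_iff[of "(pderiv ^^ M) ?u"] by auto
  obtain Z where Z: "finite Z" "card Z = M" "Z \<subseteq> {0<..<1}"
    "\<forall>w\<in>Z. poly ((pderiv ^^ M) ?u) w = 0"
    using higher_pderiv_roots_unit_interval[of M M] by auto
  then have "Z \<noteq> {}"
    using assms by auto
  then obtain W where W: "finite W" "Suc (card W) = M" "W \<subseteq> {Min Z<..<Max Z}"
    "\<forall>w\<in>W. poly (pderiv ((pderiv ^^ M) ?u)) w = 0"
    using pderiv_roots_between_roots[of Z "(pderiv ^^ M) ?u"] Z by metis
  have "Min Z \<in> {0<..<1}" and "Max Z \<in> {0<..<1}"
    using Z \<open>Z \<noteq> {}\<close> Min_in Max_in by blast+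
  then have sub01: "W \<subseteq> {0<..<1}"
    using W(3) unfolding subset_eq greaterThanLessThan_iff by (meson less_trans)
  have "W \<subseteq> {x. poly (pderiv (shifted_legendre M)) x = 0}"
    using W(4) by (auto simp: c pderiv_smult)
  \<comment> \<open>The degree is \<open>M - 1\<close>, so the \<open>M - 1\<close> roots found by
    Rolle between the \<open>M\<close> roots of the Legendre polynomial are all of them.\<close>
  moreover have "card {x. poly (pderiv (shifted_legendre M)) x = 0} \<le> card W"
    using card_poly_roots_bound[OF nz] deg W(2) by simp
  ultimately have "W = {x. poly (pderiv (shifted_legendre M)) x = 0}"
    by (intro card_seteq poly_roots_finite nz)
  then show "{x. poly (pderiv (shifted_legendre M)) x = 0} \<subseteq> {0<..<1}"
    and "card {x. poly (pderiv (shifted_legendre M)) x = 0} = M - 1"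
    using W(2) sub01 by simp_all
qed

subsection \<open>Gauss-Lobatto quadrature\<close>

lemma gl_nodes_finite_card:
  assumes "M \<ge> 1"
  shows "finite (gl_nodes M)" and "card (gl_nodes M) = Suc M" and "gl_nodes M \<subseteq> {0..1}"
proof -
  let ?R = "{x. poly (pderiv (shifted_legendre M)) x = 0}"
  note R = pderiv_shifted_legendre_roots[OF assms]
  have fin: "finite ?R"
    using R(1) by (rule poly_roots_finite)
  then show "finite (gl_nodes M)"
    by (simp add: gl_nodes_def)
  have "{0, 1} \<inter> ?R = {}"
    using R(3) by auto
  then have "card (gl_nodes M) = card {0, 1::real} + card ?R"
    using fin unfolding gl_nodes_def by (intro card_Un_disjoint) simp_all
  then show "card (gl_nodes M) = Suc M"
    using R(4) assms by simp
  show "gl_nodes M \<subseteq> {0..1}"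
    using R(3) by (auto simp: gl_nodes_def)
qed

lemma gl_node_less:
  assumes "M \<ge> 1" and "i < j" and "j \<le> M"
  shows "gl_node M i < gl_node M j"
  unfolding gl_node_def
  using assms gl_nodes_finite_card[OF assms(1)]
  by (intro sorted_wrt_nth_less[OF strict_sorted_list_of_set]) simp_all

lemma gl_node_inj: "M \<ge> 1 \<Longrightarrow> inj_on (gl_node M) {..M}"
  by (rule strict_mono_on_imp_inj_on) (simp add: strict_mono_on_def gl_node_less)

lemma gl_node_eq_iff:
  "M \<ge> 1 \<Longrightarrow> i \<le> M \<Longrightarrow> j \<le> M \<Longrightarrow> gl_node M i = gl_node M j \<longleftrightarrow> i = j"
  using inj_on_eq_iff[OF gl_node_inj] by simp

lemma gl_node_image:
  assumes "M \<ge> 1"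
  shows "gl_node M ` {..M} = gl_nodes M"
proof -
  let ?xs = "sorted_list_of_set (gl_nodes M)"
  have "gl_nodes M = set ?xs"
    using gl_nodes_finite_card[OF assms] by simp
  also have "\<dots> = (!) ?xs ` {0..<length ?xs}"
    by (simp add: nth_image)
  also have "{0..<length ?xs} = {..M}"
    using gl_nodes_finite_card[OF assms] by (simp add: atLeast0LessThan lessThan_Suc_atMost)
  also have "(!) ?xs ` {..M} = gl_node M ` {..M}"
    by (rule image_cong) (simp_all add: gl_node_def)
  finally show ?thesis ..
qed

lemma gl_node_endpoints:
  assumes "M \<ge> 1"
  shows "gl_node M 0 = 0" and "gl_node M M = 1"
proof -
  have in01: "gl_node M i \<in> {0..1}" if "i \<le> M" for i
    using gl_node_image[OF assms] gl_nodes_finite_card(3)[OF assms] that by blast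
  have "0 \<in> gl_node M ` {..M}" and "1 \<in> gl_node M ` {..M}"
    unfolding gl_node_image[OF assms] by (simp_all add: gl_nodes_def)
  then obtain i j where i: "i \<le> M" "gl_node M i = 0" and j: "j \<le> M" "gl_node M j = 1"
    by (metis atMost_iff imageE)
  have "\<not> 0 < i"
    using gl_node_less[OF assms, of 0 i] i in01[of 0] by auto
  then show "gl_node M 0 = 0"
    using i by simp
  have False if "j < M"
    using gl_node_less[OF assms that] j in01[of M] by auto
  then have "j = M"
    using j(1) by (meson le_neq_implies_less)
  then show "gl_node M M = 1"
    using j by simp
qed

section \<open>Lagrange interpolation at the nodes\<close>

lemma poly_gl_lagrange_node:
  assumes "M \<ge> 1" and "k \<le> M" and "m \<le> M"
  shows "poly (gl_lagrange M m) (gl_node M k) = (if k = m then 1 else 0)"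
proof (cases "k = m")
  case True
  then show ?thesis
    using assms
    by (auto simp: gl_lagrange_def poly_prod gl_node_eq_iff diff_divide_distrib[symmetric]
        intro!: prod.neutral)
next
  case False
  then show ?thesis
    using assms by (auto simp: gl_lagrange_def poly_prod intro!: prod_zero bexI[of _ k])
qed

lemma degree_gl_lagrange:
  assumes "m \<le> M"
  shows "degree (gl_lagrange M m) \<le> M"
proof -
  have "degree (gl_lagrange M m) \<le>
      (\<Sum>k\<in>{..M} - {m}. degree (smult (1 / (gl_node M m - gl_node M k)) [:- gl_node M k, 1:]))"
    unfolding gl_lagrange_def by (rule degree_prod_sum_le[unfolded o_def]) simp
  also have "\<dots> \<le> (\<Sum>k\<in>{..M} - {m}. 1)"
    by (intro sum_mono) simp
  also have "\<dots> = M"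
    using assms by simp
  finally show ?thesis .
qed

lemma poly_eq_on_gl_nodes:
  assumes "M \<ge> 1" and "degree p \<le> M" and "degree q \<le> M"
    and "\<And>k. k \<le> M \<Longrightarrow> poly p (gl_node M k) = poly q (gl_node M k)"
  shows "p = q"
proof (rule poly_eqI_degree)
  show "poly p x = poly q x" if "x \<in> gl_nodes M" for x
    using that assms(4) unfolding gl_node_image[OF assms(1), symmetric] by auto
qed (use assms gl_nodes_finite_card[OF assms(1)] in auto)

definition gl_interpolant :: "nat \<Rightarrow> (nat \<Rightarrow> real) \<Rightarrow> real poly" where
  "gl_interpolant M v = (\<Sum>m\<le>M. smult (v m) (gl_lagrange M m))"

lemma degree_gl_interpolant: "degree (gl_interpolant M v) \<le> M"
  unfolding gl_interpolant_def
  by (intro degree_sum_le) (auto intro: degree_smult_le[THEN order_trans] degree_gl_lagrange)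

lemma poly_gl_interpolant_node:
  "M \<ge> 1 \<Longrightarrow> k \<le> M \<Longrightarrow> poly (gl_interpolant M v) (gl_node M k) = v k"
  by (simp add: gl_interpolant_def poly_sum poly_gl_lagrange_node mult_delta_right)

lemma gl_interpolant_poly:
  "M \<ge> 1 \<Longrightarrow> degree p \<le> M \<Longrightarrow> gl_interpolant M (\<lambda>k. poly p (gl_node M k)) = p"
  by (rule poly_eq_on_gl_nodes[of M])
    (simp_all add: degree_gl_interpolant poly_gl_interpolant_node)

section \<open>Exactness of the quadrature and positivity of the weights\<close>

lemma gl_weight_eq: "gl_weight M m = poly_integral (gl_lagrange M m)"
  by (simp add: gl_weight_def poly_integral_def)

text \<open>The weights are the integrals of the Lagrange basis, and a polynomial of degree at most
  \<open>M\<close> equals its interpolant.\<close>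

lemma gl_quadrature_interpolant:
  "M \<ge> 1 \<Longrightarrow> degree p \<le> M \<Longrightarrow> gl_quadrature M (poly p) = poly_integral p"
  by (subst (2) gl_interpolant_poly[symmetric, of M])
    (simp_all add: gl_interpolant_def gl_quadrature_def gl_weight_eq poly_integral_sum
      poly_integral_smult mult.commute)

theorem gl_quadrature_exact:
  assumes "M \<ge> 1" and "degree f \<le> 2 * M - 1"
  shows "gl_quadrature M (poly f) = poly_integral f"
proof -
  let ?P = "shifted_legendre M"
  define q :: "real poly" where "q = [:0, -1, 1:]"
  have q: "q \<noteq> 0" "degree q = 2" "poly q 0 = 0" "poly q 1 = 0"
    by (simp_all add: q_def)
  \<comment> \<open>\<open>N\<close> vanishes at every node, so the quadrature sees only the
    remainder of \<open>f\<close> modulo \<open>N\<close>; this remainder has degree at most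
    \<open>M\<close>, where interpolation is exact.\<close>
  define N where "N = q * pderiv ?P"
  define g where "g = f div N"
  define r where "r = f mod N"
  note P = pderiv_shifted_legendre_roots[OF assms(1)]
  have "N \<noteq> 0" and degN: "degree N = Suc M"
    using P(1,2) assms(1) q by (simp_all add: N_def degree_mult_eq)
  have f: "f = N * g + r"
    by (simp add: g_def r_def)
  have degr: "degree r \<le> M"
    using degree_mod_less'[of N f] \<open>N \<noteq> 0\<close> degN by (cases "r = 0") (auto simp: r_def)
  have "poly_integral (N * g) = 0"
  proof (cases "g = 0")
    case False
    have "degree (N * g) \<le> 2 * M - 1"
    proof -
      have "N * g = f - r"
        using f by simp
      then show ?thesis
        using degree_diff_le[of f "2 * M - 1" r] assms degr by simp
    qed
    \<comment> \<open>Thus \<open>g\<close> has degree at most \<open>M - 2\<close>, and the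
      derivative of \<open>q * g\<close> has degree below \<open>M\<close>, as orthogonality
      requires. Since \<open>q\<close> vanishes at 0 and 1, the integration by parts leaves no
      boundary terms.\<close>
    then have "Suc M + degree g \<le> 2 * M - 1"
      using False \<open>N \<noteq> 0\<close> degN by (simp add: degree_mult_eq)
    then have "degree (pderiv (q * g)) < M"
      using False q by (simp add: degree_pderiv degree_mult_eq)
    then have "poly_integral (?P * pderiv (q * g)) = 0"
      by (rule shifted_legendre_orthogonal)
    then have "poly_integral (pderiv ?P * (q * g)) = 0"
      by (simp add: poly_integral_by_parts q)
    then show ?thesis
      by (simp only: N_def mult_ac)
  qed simp
  moreover have "gl_quadrature M (poly f) = gl_quadrature M (poly r)"
    unfolding gl_quadrature_def
  proof (intro sum.cong refl)
    fix k
    assume "k \<in> {..M}"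
    then have "gl_node M k \<in> gl_nodes M"
      using gl_node_image[OF assms(1)] by blast
    then have "poly N (gl_node M k) = 0"
      using q by (auto simp: N_def gl_nodes_def)
    then show "gl_weight M k * poly f (gl_node M k) = gl_weight M k * poly r (gl_node M k)"
      by (simp add: f)
  qed
  moreover have "gl_quadrature M (poly r) = poly_integral r"
    using assms(1) degr by (rule gl_quadrature_interpolant)
  ultimately show ?thesis
    by (simp add: f poly_integral_add)
qed

text \<open>Leaving out the node 0 keeps the degree at \<open>M - 1\<close>. The contribution of
  that node has to be removed separately: by a factor x in the positivity of the weights, by the
  prescribed first column in the uniqueness proof.\<close>

definition gl_cofactor :: "nat \<Rightarrow> nat \<Rightarrow> real poly" where
  "gl_cofactor M m = (\<Prod>k\<in>{1..M} - {m}. [:- gl_node M k, 1:])"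

lemma degree_gl_cofactor:
  assumes "m \<in> {1..M}"
  shows "degree (gl_cofactor M m) = M - 1"
  using assms unfolding gl_cofactor_def by (subst degree_prod_sum_eq) auto

lemma poly_gl_cofactor_eq_0_iff:
  assumes "M \<ge> 1" and "m \<in> {1..M}" and "k \<in> {1..M}"
  shows "poly (gl_cofactor M m) (gl_node M k) = 0 \<longleftrightarrow> k \<noteq> m"
  using assms by (auto simp: gl_cofactor_def poly_prod prod_zero_iff gl_node_eq_iff)

lemma gl_weight_pos:
  assumes "m \<in> {1..M}"
  shows "gl_weight M m > 0"
proof -
  \<comment> \<open>The square of a Lagrange basis polynomial has degree \<open>2 * M\<close>, one too many for exactness;
    keeping the factor that vanishes at the node \<open>0\<close> unsquared lowers the degree to \<open>2 * M - 1\<close>.\<close>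
  have M: "M \<ge> 1"
    using assms by simp
  define r where "r = gl_cofactor M m"
  define p where "p = [:0, 1:] * r ^ 2"
  have "r \<noteq> 0"
    by (simp add: r_def gl_cofactor_def)
  then have "p \<noteq> 0"
    by (simp add: p_def)
  have "degree p = 1 + 2 * (M - 1)"
    using \<open>r \<noteq> 0\<close> degree_gl_cofactor[OF assms]
    by (simp add: p_def degree_mult_eq degree_power_eq r_def del: mult_pCons_left)
  then have "degree p \<le> 2 * M - 1"
    using M by simp
  have "0 < poly_integral p"
    by (rule poly_integral_pos[OF _ \<open>p \<noteq> 0\<close>]) (simp add: p_def)
  also have "\<dots> = gl_quadrature M (poly p)"
    using M \<open>degree p \<le> 2 * M - 1\<close> by (simp add: gl_quadrature_exact)
  also have "\<dots> = (\<Sum>k\<in>{m}. gl_weight M k * poly p (gl_node M k))"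
    unfolding gl_quadrature_def
  proof (rule sum.mono_neutral_right)
    show "\<forall>k\<in>{..M} - {m}. gl_weight M k * poly p (gl_node M k) = 0"
    proof
      fix k
      assume k: "k \<in> {..M} - {m}"
      show "gl_weight M k * poly p (gl_node M k) = 0"
      proof (cases "k = 0")
        case True
        then show ?thesis
          by (simp add: p_def gl_node_endpoints[OF M])
      next
        case False
        then show ?thesis
          using k assms poly_gl_cofactor_eq_0_iff[OF M assms, of k] by (simp add: p_def r_def)
      qed
    qed
  qed (use assms in auto)
  also have "\<dots> = gl_weight M m * (gl_node M m * poly r (gl_node M m) ^ 2)"
    by (simp add: p_def)
  finally have "0 < gl_weight M m * (gl_node M m * poly r (gl_node M m) ^ 2)" .
  moreover have "gl_node M m > 0"
    using gl_node_less[OF M, of 0 m] assms by (simp add: gl_node_endpoints[OF M])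
  moreover have "poly r (gl_node M m) \<noteq> 0"
    using poly_gl_cofactor_eq_0_iff[OF M assms assms] by (simp add: r_def)
  ultimately have "0 < gl_node M m * poly r (gl_node M m) ^ 2"
    by simp
  with \<open>0 < gl_weight M m * _\<close> show ?thesis
    by (rule zero_less_mult_pos2)
qed

lemma gl_quadrature_mult_lagrange:
  assumes "M \<ge> 1" and "m \<le> M"
  shows "gl_quadrature M (\<lambda>x. f x * poly (gl_lagrange M m) x) = gl_weight M m * f (gl_node M m)"
  using assms
  by (simp add: gl_quadrature_def poly_gl_lagrange_node mult_delta_right)

subsection \<open>The ADER matrices\<close>

lemma ader_Lambda_carrier: "ader_Lambda M \<in> carrier_mat (Suc M) (Suc M)"
  by (simp add: ader_Lambda_def)

lemma ader_B_carrier: "ader_B M \<in> carrier_mat (Suc M) (Suc M)"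
  by (simp add: ader_B_def)

lemma mult_mat_vec_index_sum:
  assumes "A \<in> carrier_mat n (Suc M)" and "v \<in> carrier_vec (Suc M)" and "i < n"
  shows "(A *\<^sub>v v) $ i = (\<Sum>j\<le>M. A $$ (i, j) * v $ j)"
  using assms by (simp add: scalar_prod_def atLeast0LessThan lessThan_Suc_atMost)

lemma ader_Lambda_mult_vec:
  assumes "M \<ge> 1" and "v \<in> carrier_vec (Suc M)"
  shows "ader_Lambda M *\<^sub>v v = Matrix.vec (Suc M) (\<lambda>l. gl_weight M l * v $ l)"
proof (rule eq_vecI)
  fix l
  assume "l < dim_vec (Matrix.vec (Suc M) (\<lambda>l. gl_weight M l * v $ l))"
  then have l: "l \<le> M"
    by simp
  have "(ader_Lambda M *\<^sub>v v) $ l = (\<Sum>m\<le>M. ader_Lambda M $$ (l, m) * v $ m)"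
    using l assms by (intro mult_mat_vec_index_sum[OF ader_Lambda_carrier]) simp_all
  also have "\<dots> = (\<Sum>m\<le>M. (if m = l then gl_weight M l else 0) * v $ m)"
    using l assms(1) by (intro sum.cong refl)
      (simp add: ader_Lambda_def gl_quadrature_mult_lagrange poly_gl_lagrange_node)
  also have "\<dots> = gl_weight M l * v $ l"
    using l by (simp add: mult_delta_left)
  finally show "(ader_Lambda M *\<^sub>v v) $ l = Matrix.vec (Suc M) (\<lambda>l. gl_weight M l * v $ l) $ l"
    using l by simp
qed (simp add: ader_Lambda_def)

text \<open>Exactness of the quadrature allows one to integrate by parts in the definition of \<open>B\<close>:
  \<open>\<psi>\<^sub>l(1) p(1) - \<integral> \<psi>\<^sub>l' p = \<psi>\<^sub>l(0) p(0) + \<integral> \<psi>\<^sub>l p'\<close>.\<close>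

lemma ader_B_mult_poly:
  assumes "M \<ge> 1" and "degree p \<le> M"
  shows "ader_B M *\<^sub>v Matrix.vec (Suc M) (\<lambda>m. poly p (gl_node M m)) =
    Matrix.vec (Suc M) (\<lambda>l. (if l = 0 then poly p 0 else 0) +
      gl_weight M l * poly (pderiv p) (gl_node M l))" (is "?lhs = ?rhs")
proof (rule eq_vecI)
  fix l
  assume "l < dim_vec ?rhs"
  then have l: "l \<le> M"
    by simp
  define \<psi> where "\<psi> = gl_lagrange M l"
  have deg\<psi>: "degree \<psi> \<le> M"
    using l by (simp add: \<psi>_def degree_gl_lagrange)
  have entry: "ader_B M $$ (l, m) = poly \<psi> 1 * poly (gl_lagrange M m) 1 -
      gl_weight M m * poly (pderiv \<psi>) (gl_node M m)" if "m \<le> M" for m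
    using l that gl_quadrature_mult_lagrange[OF assms(1) that] by (simp add: ader_B_def \<psi>_def)
  have p1: "(\<Sum>m\<le>M. poly p (gl_node M m) * poly (gl_lagrange M m) 1) = poly p 1"
    using arg_cong[OF gl_interpolant_poly[OF assms], of "\<lambda>q. poly q 1"]
    by (simp add: gl_interpolant_def poly_sum)
  \<comment> \<open>The degree is at most (M - 1) + M = 2 M - 1, just within the range of
    exactness.\<close>
  have exact: "gl_quadrature M (poly (pderiv f * g)) = poly_integral (pderiv f * g)"
    if "degree f \<le> M" "degree g \<le> M" for f g
  proof (rule gl_quadrature_exact[OF assms(1)])
    have "degree (pderiv f * g) \<le> (M - 1) + M"
      using that by (intro degree_mult_le[THEN order_trans] add_mono) (simp_all add: degree_pderiv)
    then show "degree (pderiv f * g) \<le> 2 * M - 1"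
      using assms(1) by simp
  qed
  have parts: "poly_integral (pderiv \<psi> * p) =
      poly \<psi> 1 * poly p 1 - poly \<psi> 0 * poly p 0 - poly_integral (pderiv p * \<psi>)"
    unfolding poly_integral_by_parts[of \<psi>] by (simp only: mult.commute)
  \<comment> \<open>The remaining integral is turned back into a quadrature sum, from which the
    Lagrange polynomial selects the node \<open>l\<close>.\<close>
  have inner: "poly_integral (pderiv p * \<psi>) = gl_weight M l * poly (pderiv p) (gl_node M l)"
    using gl_quadrature_mult_lagrange[OF assms(1) l, of "poly (pderiv p)"]
    unfolding exact[OF assms(2) deg\<psi>, symmetric] by (simp add: gl_quadrature_def \<psi>_def)
  have \<psi>0: "poly \<psi> 0 = (if l = 0 then 1 else 0)"
    using poly_gl_lagrange_node[OF assms(1) _ l, of 0] gl_node_endpoints(1)[OF assms(1)]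
    by (auto simp: \<psi>_def)
  have "?lhs $ l = (\<Sum>m\<le>M. ader_B M $$ (l, m) * poly p (gl_node M m))"
    using l by (subst mult_mat_vec_index_sum[OF ader_B_carrier]) simp_all
  also have "\<dots> = (\<Sum>m\<le>M. poly \<psi> 1 * (poly p (gl_node M m) * poly (gl_lagrange M m) 1) -
      gl_weight M m * poly (pderiv \<psi> * p) (gl_node M m))"
    by (intro sum.cong refl) (simp add: entry algebra_simps)
  also have "\<dots> = poly \<psi> 1 * poly p 1 - gl_quadrature M (poly (pderiv \<psi> * p))"
    by (simp only: sum_subtractf sum_distrib_left[symmetric] p1 gl_quadrature_def)
  also have "\<dots> = poly \<psi> 0 * poly p 0 + gl_weight M l * poly (pderiv p) (gl_node M l)"
    by (simp only: exact[OF deg\<psi> assms(2)] parts inner)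
  also have "\<dots> = ?rhs $ l"
    using l by (simp add: \<psi>0)
  finally show "?lhs $ l = ?rhs $ l" .
qed (simp add: ader_B_def)

lemma ader_B_kernel:
  assumes "M \<ge> 1" and "v \<in> carrier_vec (Suc M)" and "ader_B M *\<^sub>v v = 0\<^sub>v (Suc M)"
  shows "v = 0\<^sub>v (Suc M)"
proof -
  define p where "p = gl_interpolant M (($) v)"
  have degp: "degree p \<le> M"
    by (simp add: p_def degree_gl_interpolant)
  have v: "v = Matrix.vec (Suc M) (\<lambda>m. poly p (gl_node M m))"
    using assms by (intro eq_vecI) (simp_all add: p_def poly_gl_interpolant_node)
  have eq0: "(if l = 0 then poly p 0 else 0) + gl_weight M l * poly (pderiv p) (gl_node M l) = 0"
    if "l \<le> M" for l
    using arg_cong[OF ader_B_mult_poly[OF assms(1) degp, folded v, unfolded assms(3)], of "\<lambda>u. u $ l"] that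
    by simp
  \<comment> \<open>Only the rows \<open>l \<ge> 1\<close> are used, where the term p(0) is absent
    and the weight is positive: M zeros for a polynomial of degree at most M - 1. Row 0 is kept for
    p(0) = 0.\<close>
  have "pderiv p = 0"
  proof (rule poly_eqI_degree)
    have "card (gl_node M ` {1..M}) = M"
      using inj_on_subset[OF gl_node_inj[OF assms(1)], of "{1..M}"] by (simp add: card_image)
    then show "degree (pderiv p) < card (gl_node M ` {1..M})"
      and "degree 0 < card (gl_node M ` {1..M})"
      using assms(1) degp by (simp_all add: degree_pderiv)
    show "poly (pderiv p) x = poly 0 x" if x: "x \<in> gl_node M ` {1..M}" for x
    proof -
      obtain l where l: "l \<in> {1..M}" "x = gl_node M l"
        using x by blast
      then show ?thesis
        using eq0[of l] gl_weight_pos[of l M] by simp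
    qed
  qed
  moreover from this have "degree p = 0"
    by (simp add: pderiv_eq_0_iff)
  moreover have "poly p 0 = 0"
    using eq0[of 0] \<open>pderiv p = 0\<close> by simp
  ultimately have "p = 0"
    by (auto elim!: degree_eq_zeroE)
  then show ?thesis
    by (subst v) (auto intro: eq_vecI)
qed

text \<open>A trivial kernel makes the determinant nonzero, so \<open>mat_inverse\<close> returns
  \<open>Some\<close> and the \<open>the\<close> in the definition of the method yields the true
  inverse.\<close>

lemma mat_inverse_ader_B:
  assumes "M \<ge> 1"
  obtains C where "mat_inverse (ader_B M) = Some C" and "C \<in> carrier_mat (Suc M) (Suc M)"
    and "ader_B M * C = 1\<^sub>m (Suc M)" and "C * ader_B M = 1\<^sub>m (Suc M)"
proof -
  have "Determinant.det (ader_B M) \<noteq> 0"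
    using det_0_iff_vec_prod_zero[OF ader_B_carrier] ader_B_kernel[OF assms] by blast
  then have "ader_B M \<in> Units (ring_mat TYPE(real) (Suc M) ())"
    by (rule det_non_zero_imp_unit[OF ader_B_carrier])
  then have "mat_inverse (ader_B M) \<noteq> None"
    using mat_inverse(1)[OF ader_B_carrier] by metis
  then obtain C where C: "mat_inverse (ader_B M) = Some C"
    by auto
  show thesis
    using that[OF C] mat_inverse(2)[OF ader_B_carrier C] by simp
qed

text \<open>The last hypothesis says entrywise that B applied to the nodal values of
  \<open>p\<close> is \<Lambda> v; multiplying by the inverse of B gives A v. If p(0) = 0, nodal
  values of p' may serve as \<open>v\<close>, so A acts as integration from 0.\<close>

lemma ader_A_mult_vec:
  assumes "M \<ge> 1" and "degree p \<le> M" and "v \<in> carrier_vec (Suc M)"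
    and "\<And>l. l \<le> M \<Longrightarrow> (if l = 0 then poly p 0 else 0) +
      gl_weight M l * poly (pderiv p) (gl_node M l) = gl_weight M l * v $ l"
  shows "rk_A (ader_iwf_rk_glb M) *\<^sub>v v = Matrix.vec (Suc M) (\<lambda>m. poly p (gl_node M m))"
proof -
  let ?p = "Matrix.vec (Suc M) (\<lambda>m. poly p (gl_node M m))"
  obtain C where C: "mat_inverse (ader_B M) = Some C" "C \<in> carrier_mat (Suc M) (Suc M)"
    "C * ader_B M = 1\<^sub>m (Suc M)"
    using mat_inverse_ader_B[OF assms(1)] .
  have "ader_Lambda M *\<^sub>v v = ader_B M *\<^sub>v ?p"
    unfolding ader_Lambda_mult_vec[OF assms(1,3)] ader_B_mult_poly[OF assms(1,2)]
    using assms(4) by (intro eq_vecI) simp_all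
  then have "C * ader_Lambda M *\<^sub>v v = C * ader_B M *\<^sub>v ?p"
    using C(2) assms(3) ader_B_carrier ader_Lambda_carrier
    by (simp add: assoc_mult_mat_vec[of _ "Suc M" "Suc M" _ "Suc M"])
  then show ?thesis
    by (simp add: ader_iwf_rk_glb_def C)
qed

section \<open>Identification with the Lobatto IIIC method\<close>

lemma ader_is_lobatto_IIIC:
  assumes "M \<ge> 1"
  shows "is_lobatto_IIIC (Suc M) (ader_iwf_rk_glb M)"
proof -
  let ?R = "ader_iwf_rk_glb M"
  obtain C where C: "mat_inverse (ader_B M) = Some C" "C \<in> carrier_mat (Suc M) (Suc M)"
    using mat_inverse_ader_B[OF assms] .
  have A: "rk_A ?R \<in> carrier_mat (Suc M) (Suc M)"
    using C ader_Lambda_carrier[of M] by (simp add: ader_iwf_rk_glb_def)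
  have bc: "rk_b ?R = Matrix.vec (Suc M) (gl_weight M)" "rk_c ?R = Matrix.vec (Suc M) (gl_node M)"
    by (simp_all add: ader_iwf_rk_glb_def)
  have "rk_A ?R $$ (i, 0) = gl_weight M 0" if "i \<le> M" for i
  proof -
    \<comment> \<open>For the constant p = w_0 the derivative vanishes and only row 0 is nonzero,
      with value w_0: this is \<Lambda> applied to the first unit vector.\<close>
    have "rk_A ?R *\<^sub>v unit_vec (Suc M) 0 =
        Matrix.vec (Suc M) (\<lambda>m. poly [:gl_weight M 0:] (gl_node M m))"
      using assms by (intro ader_A_mult_vec) simp_all
    then have "(rk_A ?R *\<^sub>v unit_vec (Suc M) 0) $ i = gl_weight M 0"
      using that by simp
    moreover have "(rk_A ?R *\<^sub>v unit_vec (Suc M) 0) $ i = rk_A ?R $$ (i, 0)"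
      using that A by simp
    ultimately show ?thesis
      by simp
  qed
  moreover have "rk_C (Suc M) M ?R"
    unfolding rk_C_def
  proof (intro allI impI ballI)
    fix i z
    assume i: "i < Suc M" and z: "z \<in> {1..M}"
    \<comment> \<open>Here p = x^z / z has degree at most \<open>M\<close>, vanishes at 0 because
      \<open>z \<ge> 1\<close>, and has derivative x^(z-1).\<close>
    have "rk_A ?R *\<^sub>v Matrix.vec (Suc M) (\<lambda>j. gl_node M j ^ (z - 1)) =
        Matrix.vec (Suc M) (\<lambda>m. poly (monom (1 / real z) z) (gl_node M m))"
      using assms z
      by (intro ader_A_mult_vec)
        (simp_all add: degree_monom_eq pderiv_monom poly_monom)
    then have "(rk_A ?R *\<^sub>v Matrix.vec (Suc M) (\<lambda>j. gl_node M j ^ (z - 1))) $ i = gl_node M i ^ z / real z"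
      using i by (simp add: poly_monom)
    then have "(\<Sum>j\<le>M. rk_A ?R $$ (i, j) * gl_node M j ^ (z - 1)) = gl_node M i ^ z / real z"
      using i by (subst (asm) mult_mat_vec_index_sum[OF A]) simp_all
    then show "(\<Sum>j<Suc M. rk_A ?R $$ (i, j) * rk_c ?R $ j ^ (z - 1)) = rk_c ?R $ i ^ z / real z"
      using i by (simp add: bc lessThan_Suc_atMost)
  qed
  ultimately show ?thesis
    using A by (simp add: is_lobatto_IIIC_def rk_stages_def bc)
qed

text \<open>By \<open>C(M)\<close> the rows of the two matrices agree as functionals on polynomials of degree below
  \<open>M\<close>; since their entries in column 0 agree too, testing with the polynomial that vanishes at all
  nodes but \<open>\<xi>\<^sup>0\<close> and \<open>\<xi>\<^sup>j\<close> isolates column \<open>j\<close>.\<close>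

lemma is_lobatto_IIIC_unique:
  assumes "M \<ge> 1" and R: "is_lobatto_IIIC (Suc M) R" and R': "is_lobatto_IIIC (Suc M) R'"
  shows "R = R'"
proof -
  have carr: "rk_A R \<in> carrier_mat (Suc M) (Suc M)" "rk_A R' \<in> carrier_mat (Suc M) (Suc M)"
    "rk_b R \<in> carrier_vec (Suc M)" "rk_b R' \<in> carrier_vec (Suc M)"
    "rk_c R \<in> carrier_vec (Suc M)" "rk_c R' \<in> carrier_vec (Suc M)"
    using R R' by (simp_all add: is_lobatto_IIIC_def rk_stages_def)
  have b: "rk_b R = rk_b R'" and c: "rk_c R = rk_c R'"
    using R R' carr by (auto intro!: eq_vecI simp: is_lobatto_IIIC_def)
  have node: "rk_c R $ j = gl_node M j" if "j \<le> M" for j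
    using R that by (simp add: is_lobatto_IIIC_def)
  have "rk_A R = rk_A R'"
  proof (rule eq_matI)
    fix i j
    assume "i < dim_row (rk_A R')" and "j < dim_col (rk_A R')"
    then have i: "i \<le> M" and j: "j \<le> M"
      using carr by auto
    define d where "d k = rk_A R $$ (i, k) - rk_A R' $$ (i, k)" for k
    have d0: "d 0 = 0"
      using R R' i b by (simp add: d_def is_lobatto_IIIC_def)
    \<comment> \<open>The condition with z = n + 1 has a right-hand side depending only on the
      nodes, so it cancels in the difference of the rows. The range z <= M becomes n < M.\<close>
    have mono: "(\<Sum>k\<le>M. d k * gl_node M k ^ n) = 0" if "n < M" for n
    proof -
      have row: "(\<Sum>k<Suc M. rk_A Q $$ (i, k) * rk_c Q $ k ^ n) = rk_c Q $ i ^ Suc n / real (Suc n)"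
        if "is_lobatto_IIIC (Suc M) Q" for Q
      proof -
        have "rk_C (Suc M) M Q"
          using that by (simp add: is_lobatto_IIIC_def)
        from this[unfolded rk_C_def, rule_format, of i "Suc n"] show ?thesis
          using i \<open>n < M\<close> by simp
      qed
      have "(\<Sum>k<Suc M. rk_A R $$ (i, k) * rk_c R $ k ^ n) = (\<Sum>k<Suc M. rk_A R' $$ (i, k) * rk_c R $ k ^ n)"
        using row[OF R] row[OF R'] unfolding c by (rule trans[OF _ sym])
      then have "(\<Sum>k<Suc M. d k * rk_c R $ k ^ n) = 0"
        by (simp add: d_def left_diff_distrib sum_subtractf)
      then show ?thesis
        by (simp add: lessThan_Suc_atMost node)
    qed
    have test: "(\<Sum>k\<le>M. d k * poly q (gl_node M k)) = 0" if "degree q < M" for q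
    proof -
      have "(\<Sum>k\<le>M. d k * poly q (gl_node M k)) =
          (\<Sum>n\<le>degree q. coeff q n * (\<Sum>k\<le>M. d k * gl_node M k ^ n))"
        unfolding poly_altdef sum_distrib_left by (subst sum.swap) (simp add: mult_ac)
      also have "\<dots> = 0"
        using that mono by simp
      finally show ?thesis .
    qed
    have "d j = 0"
    proof (cases "j = 0")
      case False
      then have j1: "j \<in> {1..M}"
        using j by simp
      have "0 = (\<Sum>k\<le>M. d k * poly (gl_cofactor M j) (gl_node M k))"
        using degree_gl_cofactor[OF j1] assms(1) by (intro test[symmetric]) simp
      also have "\<dots> = (\<Sum>k\<in>{j}. d k * poly (gl_cofactor M j) (gl_node M k))"
      proof (rule sum.mono_neutral_right)
        show "\<forall>k\<in>{..M} - {j}. d k * poly (gl_cofactor M j) (gl_node M k) = 0"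
        proof
          fix k
          assume "k \<in> {..M} - {j}"
          then show "d k * poly (gl_cofactor M j) (gl_node M k) = 0"
            using d0 poly_gl_cofactor_eq_0_iff[OF assms(1) j1, of k] by (cases "k = 0") simp_all
        qed
      qed (use j in auto)
      finally show ?thesis
        using poly_gl_cofactor_eq_0_iff[OF assms(1) j1 j1] by simp
    qed (use d0 in simp)
    then show "rk_A R $$ (i, j) = rk_A R' $$ (i, j)"
      by (simp add: d_def)
  qed (use carr in auto)
  then show ?thesis
    using b c by simp
qed

theorem theoremB3:
  fixes M :: nat
  assumes "M \<ge> 1"
  shows "invertible_mat (ader_B M)
    \<and> (\<exists>!R. is_lobatto_IIIC (M + 1) R)
    \<and> ader_iwf_rk_glb M = lobatto_IIIC (M + 1)"
proof -
  obtain C where "C \<in> carrier_mat (Suc M) (Suc M)"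
    and "ader_B M * C = 1\<^sub>m (Suc M)" and "C * ader_B M = 1\<^sub>m (Suc M)"
    using mat_inverse_ader_B[OF assms] .
  then have "invertible_mat (ader_B M)"
    using ader_B_carrier[of M] by (auto simp: invertible_mat_def inverts_mat_def)
  moreover have ex1: "\<exists>!R. is_lobatto_IIIC (M + 1) R"
    using ader_is_lobatto_IIIC[OF assms] is_lobatto_IIIC_unique[OF assms]
    unfolding Suc_eq_plus1 by blast
  \<comment> \<open>\<open>lobatto_IIIC\<close> is a definite description, so its value can be read
    off only once unique existence is known.\<close>
  moreover have "lobatto_IIIC (M + 1) = ader_iwf_rk_glb M"
    unfolding lobatto_IIIC_def
    by (rule the1_equality[OF ex1]) (use ader_is_lobatto_IIIC[OF assms] in simp)
  ultimately show ?thesis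
    by simp
qed

end
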